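(* Let $\xi_0,\xi_1,\xi_2,\dots$ be i.i.d. real- or complex-valued random variables with $\mathbf{P}\{\xi_0=0\}=0$, and for each $n\geqslant 1$ let $G_n(z)=\xi_n z^n+\xi_{n-1}z^{n-1}+\dots+\xi_1 z+\xi_0$. For $0<a<b$ let $R_n(a,b)$ denote the number of complex roots of $G_n$ contained in the ring $\{z\in\mathbb{C}: a\leqslant |z|\leqslant b\}$. If the distribution of $|\xi_0|$ has a slowly varying tail, then for any $\delta>0$ $$\mathbf{P}\{R_n(e^{-\delta/n},e^{\delta/n})=0\}\longrightarrow 1,\quad n\to\infty.$$
   Context: A non-negative random variable $X$ has a slowly varying tail if $T(x)=\mathbf{P}\{X>x\}$ is positive for all $x>0$ and $T(cx)/T(x)\to 1$ as $x\to\infty$ for every $c>0$. *)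

theory Defs
  imports "HOL-Probability.Probability" "HOL-Computational_Algebra.Polynomial"
    "HOL-Library.Extended_Nat"
begin

definition slowly_varying_tail :: "'a measure \<Rightarrow> ('a \<Rightarrow> real) \<Rightarrow> bool" where
  "slowly_varying_tail M X \<longleftrightarrow>
     (\<forall>x>0. measure M {\<omega> \<in> space M. X \<omega> > x} > 0) \<and>
     (\<forall>c>0. ((\<lambda>x. measure M {\<omega> \<in> space M. X \<omega> > c * x} /
                  measure M {\<omega> \<in> space M. X \<omega> > x}) \<longlongrightarrow> 1) at_top)"

definition random_poly :: "(nat \<Rightarrow> 'a \<Rightarrow> complex) \<Rightarrow> nat \<Rightarrow> 'a \<Rightarrow> complex poly" where
  "random_poly \<xi> n \<omega> = (\<Sum>k\<le>n. monom (\<xi> k \<omega>) k)"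

(* Roots are counted with multiplicity.  The zero polynomial vanishes on the whole ring,
   hence the value \<infinity>; without this case the infinite sum would silently be 0. *)
definition ring_roots :: "real \<Rightarrow> real \<Rightarrow> complex poly \<Rightarrow> enat" where
  "ring_roots a b p =
     (if p = 0 then \<infinity>
      else enat (\<Sum>z | poly p z = 0 \<and> a \<le> cmod z \<and> cmod z \<le> b. order z p))"

end

theory Submission
  imports Defs
begin

text \<open>
  Write \<open>T\<close> for the common tail of \<open>X\<^sub>k = \<bar>\<xi>\<^sub>k\<bar>\<close>. Slow variation of \<open>T\<close> forces
  \<open>E[X; X \<le> x] = o(x T(x))\<close>. Fix \<open>\<epsilon> > 0\<close> and suppose that the largest of \<open>N\<close> sample values
  exceeds \<open>u\<close> but not \<open>1/\<epsilon>\<close> times the sum of the others. Then the sum of \<open>X\<^sub>j / X\<^sub>k\<close> over all pairs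
  \<open>j \<noteq> k\<close> with \<open>X\<^sub>j \<le> X\<^sub>k\<close> and \<open>X\<^sub>k > u\<close> is at least \<open>\<epsilon>\<close>. The expectation of this sum is at most
  \<open>N\<^sup>2 o(T(u)) T(u)\<close>, while \<open>P(max X\<^sub>k \<le> u) \<le> exp (- N T(u))\<close>, so choosing \<open>u\<close> with \<open>N T(u)\<close> of the
  order of a large constant shows that with probability close to one a single coefficient exceeds
  the sum of all others by any prescribed factor. On the ring every \<open>\<bar>z\<^sup>k\<bar>\<close> with \<open>k \<le> n\<close> lies
  between \<open>exp (- \<delta>)\<close> and \<open>exp \<delta>\<close>, so with the factor \<open>exp (2 \<delta>)\<close> the dominant monomial
  cannot be cancelled.
\<close>

section \<open>Truncated means under a slowly varying tail\<close>

text \<open>The number \<open>3 * \<eta>\<close> is the fixed point of t -> 2/3 t +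
  \<open>\<eta>\<close>, so each halving of \<open>x\<close> shrinks only the part of the bound
  above it. After \<open>n\<close> halvings the argument is still at least \<open>x0\<close>, where
  \<open>B + 3 * \<eta>\<close> serves as a bound.\<close>

lemma half_recursion_bound:
  fixes r :: "real \<Rightarrow> real"
  assumes x0: "x0 > 0" and B: "B \<ge> 0" and \<eta>: "\<eta> \<ge> 0"
    and rec: "\<And>x. x \<ge> 2 * x0 \<Longrightarrow> r x \<le> 2/3 * r (x/2) + \<eta>"
    and base: "\<And>x. x0 \<le> x \<Longrightarrow> x \<le> 2 * x0 \<Longrightarrow> r x \<le> B"
    and x: "x \<ge> x0 * 2 ^ n"
  shows "r x \<le> (2/3) ^ n * B + 3 * \<eta>"
  using x
proof (induction n arbitrary: x)
  case 0
  \<comment> \<open>The case \<open>n = 0\<close> already needs a bound on all of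
    \<open>[x0, \<infinity>)\<close>. It spreads from the base window over dyadic windows, because
    2/3 (B + 3 \<eta>) + \<eta> \<le> B + 3 \<eta>.\<close>
  have *: "r x \<le> B + 3 * \<eta>" if "x0 \<le> x" "x \<le> x0 * 2 ^ Suc m" for m x
    using that
  proof (induction m arbitrary: x)
    case 0
    then show ?case using base[of x] \<eta> by (simp add: mult.commute)
  next
    case (Suc m)
    show ?case
    proof (cases "x \<le> 2 * x0")
      case True
      then show ?thesis using base[of x] Suc.prems \<eta> by simp
    next
      case False
      then have "r (x/2) \<le> B + 3 * \<eta>"
        using Suc.prems by (intro Suc.IH) auto
      then show ?thesis using rec[of x] False B by simp
    qed
  qed
  obtain m where "x / x0 < 2 ^ m"
    using real_arch_pow[of 2 "x / x0"] by auto
  then have "x < x0 * 2 ^ m"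
    using x0 by (simp add: pos_divide_less_eq mult.commute)
  also have "\<dots> \<le> x0 * 2 ^ Suc m" using x0 by simp
  finally have "x \<le> x0 * 2 ^ Suc m" by simp
  then show ?case using *[of x m] 0 by simp
next
  case (Suc n)
  have half: "x / 2 \<ge> x0 * 2 ^ n" using Suc.prems by simp
  moreover have "x0 * 1 \<le> x0 * 2 ^ n" using x0 by (intro mult_left_mono) auto
  ultimately have "x \<ge> 2 * x0" by simp
  then have "r x \<le> 2/3 * r (x/2) + \<eta>" by (rule rec)
  also have "\<dots> \<le> 2/3 * ((2/3) ^ n * B + 3 * \<eta>) + \<eta>"
    using Suc.IH[OF half] by (intro add_right_mono mult_left_mono) auto
  finally have "r x \<le> 2/3 * ((2/3) ^ n * B + 3 * \<eta>) + \<eta>" .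
  then show ?case by (simp add: algebra_simps)
qed

text \<open>A limit factor below 1 is eventually below the fixed contraction 2/3, and local
  boundedness supplies a finite starting value on one window \<open>[x0, 2 * x0]\<close>.
  Nonnegativity of \<open>r\<close> allows \<open>c x\<close> to be replaced by 2/3.\<close>

lemma half_recursion_tendsto_0:
  fixes r c d :: "real \<Rightarrow> real"
  assumes rec: "\<forall>\<^sub>F x in at_top. r x \<le> c x * r (x/2) + d x"
    and c: "(c \<longlongrightarrow> 1/2) at_top" and d: "(d \<longlongrightarrow> 0) at_top"
    and nonneg: "\<And>x. r x \<ge> 0"
    and bdd: "\<And>a b. 0 < a \<Longrightarrow> \<exists>B. \<forall>x. a \<le> x \<and> x \<le> b \<longrightarrow> r x \<le> B"
  shows "(r \<longlongrightarrow> 0) at_top"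
proof (rule order_tendstoI)
  fix \<epsilon> :: real assume \<epsilon>: "0 < \<epsilon>"
  \<comment> \<open>With error \<open>\<epsilon>/6\<close> the fixed point is
    \<open>\<epsilon>/2\<close>, which leaves \<open>\<epsilon>/2\<close> for the geometric
    term.\<close>
  have "\<forall>\<^sub>F x in at_top. c x < 2/3" "\<forall>\<^sub>F x in at_top. d x < \<epsilon>/6"
    using order_tendstoD(2)[OF c, of "2/3"] order_tendstoD(2)[OF d, of "\<epsilon>/6"] \<epsilon> by auto
  with rec eventually_gt_at_top[of 0]
  have "\<forall>\<^sub>F x in at_top. x > 0 \<and> r x \<le> 2/3 * r (x/2) + \<epsilon>/6"
  proof eventually_elim
    case (elim x)
    then have "c x * r (x/2) \<le> 2/3 * r (x/2)"
      by (intro mult_right_mono nonneg) auto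
    then show ?case using elim by simp
  qed
  then obtain x0 where x0: "\<And>x. x \<ge> x0 \<Longrightarrow> x > 0 \<and> r x \<le> 2/3 * r (x/2) + \<epsilon>/6"
    by (auto simp: eventually_at_top_linorder)
  then have pos: "x0 > 0" by blast
  obtain B0 where B0: "\<And>x. x0 \<le> x \<Longrightarrow> x \<le> 2 * x0 \<Longrightarrow> r x \<le> B0"
    using bdd[OF pos, of "2 * x0"] by blast
  have B: "B0 \<ge> 0" using B0[of x0] nonneg[of x0] pos by simp
  have "(\<lambda>n. (2/3) ^ n * B0) \<longlonglongrightarrow> 0"
    by (intro tendsto_mult_left_zero LIMSEQ_realpow_zero) auto
  then have "\<forall>\<^sub>F n in sequentially. (2/3) ^ n * B0 < \<epsilon>/2"
    using \<epsilon> by (intro order_tendstoD) auto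
  then obtain n where n: "(2/3) ^ n * B0 < \<epsilon>/2"
    by (auto simp: eventually_sequentially)
  have "r x < \<epsilon>" if "x \<ge> x0 * 2 ^ n" for x
  proof -
    have "r x \<le> (2/3) ^ n * B0 + 3 * (\<epsilon>/6)"
    proof (rule half_recursion_bound[OF pos B _ _ B0 that])
      show "r y \<le> 2/3 * r (y/2) + \<epsilon>/6" if "2 * x0 \<le> y" for y
        using x0[of y] that pos by simp
    qed (use \<epsilon> in auto)
    then show ?thesis using n by simp
  qed
  then show "\<forall>\<^sub>F x in at_top. r x < \<epsilon>"
    by (auto simp: eventually_at_top_linorder)
qed (use nonneg in \<open>simp add: less_le_trans\<close>)

definition truncated_mean :: "real measure \<Rightarrow> real \<Rightarrow> real" where
  "truncated_mean D x = (\<integral>y. y * indicator {0<..x} y \<partial>D)"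

context real_distribution
begin

lemma integrable_truncation: "integrable M (\<lambda>y. y * indicator {0<..x} y)"
  by (rule integrable_const_bound[of _ "\<bar>x\<bar>"]) (auto simp: indicator_def)

lemma truncated_mean_nonneg: "truncated_mean M x \<ge> 0"
  unfolding truncated_mean_def by (intro integral_nonneg_AE) (auto simp: indicator_def)

lemma truncated_mean_le: "x \<ge> 0 \<Longrightarrow> truncated_mean M x \<le> x"
proof -
  assume "x \<ge> 0"
  then have "truncated_mean M x \<le> (\<integral>y. x \<partial>M)"
    unfolding truncated_mean_def
    by (intro integral_mono integrable_truncation) (auto simp: indicator_def)
  then show ?thesis using prob_space by simp
qed

lemma tail_antimono: "x \<le> y \<Longrightarrow> prob {y<..} \<le> prob {x<..}" for x y :: real
  by (intro finite_measure_mono) auto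

lemma tail_tendsto_0: "((\<lambda>x. prob {x<..}) \<longlongrightarrow> 0) at_top"
proof -
  have "prob {x<..} = 1 - cdf M x" for x
    using prob_compl[of "{..x}"] sets_eq_imp_space_eq[OF events_eq_borel]
    by (simp add: cdf_def Compl_eq_Diff_UNIV[symmetric] Compl_atMost)
  then show ?thesis
    using tendsto_diff[OF tendsto_const[of 1] cdf_lim_at_top_prob] by simp
qed

text \<open>Cut at \<open>x/2\<close>: on the remaining interval \<open>{x/2<..x}\<close> the
  integrand is at most \<open>x\<close>, and the mass of that interval is a difference of
  tails.\<close>

lemma truncated_mean_half:
  assumes "x > 0"
  shows "truncated_mean M x \<le> truncated_mean M (x/2) + x * (prob {x/2<..} - prob {x<..})"
proof -
  have "truncated_mean M x
      \<le> (\<integral>y. y * indicator {0<..x/2} y + x * (indicator {x/2<..} y - indicator {x<..} y) \<partial>M)"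
    unfolding truncated_mean_def using assms
    by (intro integral_mono integrable_truncation Bochner_Integration.integrable_add
         integrable_mult_right Bochner_Integration.integrable_diff integrable_real_indicator)
       (auto simp: indicator_def emeasure_eq_measure)
  also have "\<dots> = truncated_mean M (x/2) + x * (prob {x/2<..} - prob {x<..})"
    unfolding truncated_mean_def
    by (subst Bochner_Integration.integral_add)
       (auto intro!: integrable_truncation integrable_mult_right Bochner_Integration.integrable_diff
         integrable_real_indicator simp: emeasure_eq_measure)
  finally show ?thesis .
qed

text \<open>Divide the splitting at \<open>x/2\<close> by x T(x), where T is the tail. With q =
  T(x/2)/T(x) the quotient r satisfies r(x) \<le> (q/2) r(x/2) + (q - 1), and slow variation sends
  q/2 to 1/2 and q - 1 to 0.\<close>

lemma truncated_mean_small_o: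
  assumes pos: "\<And>x. prob {x<..} > 0"
    and sv: "((\<lambda>x. prob {x/2<..} / prob {x<..}) \<longlongrightarrow> 1) at_top"
  shows "((\<lambda>x. truncated_mean M x / x / prob {x<..}) \<longlongrightarrow> 0) at_top"
proof -
  define r where "r x = (if x > 0 then truncated_mean M x / x / prob {x<..} else 0)" for x
  let ?q = "\<lambda>x. prob {x/2<..} / prob {x<..}"
  have "(r \<longlongrightarrow> 0) at_top"
  proof (rule half_recursion_tendsto_0)
    show "\<forall>\<^sub>F x in at_top. r x \<le> ?q x / 2 * r (x/2) + (?q x - 1)"
      using eventually_gt_at_top[of 0]
    proof eventually_elim
      case (elim x)
      have "r x \<le> (truncated_mean M (x/2) + x * (prob {x/2<..} - prob {x<..})) / x / prob {x<..}"
        using elim truncated_mean_half[of x] pos[of x]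
        by (auto simp: r_def intro!: divide_right_mono)
      also have "\<dots> = ?q x / 2 * r (x/2) + (?q x - 1)"
        using elim pos[of x] pos[of "x/2"] by (simp add: r_def field_simps)
      finally show ?case .
    qed
    show "((\<lambda>x. ?q x / 2) \<longlongrightarrow> 1/2) at_top" "((\<lambda>x. ?q x - 1) \<longlongrightarrow> 0) at_top"
      using tendsto_divide[OF sv tendsto_const[of 2]] tendsto_diff[OF sv tendsto_const[of 1]] by auto
    show "r x \<ge> 0" for x
      by (simp add: r_def truncated_mean_nonneg)
    \<comment> \<open>On a bounded window the truncated mean is at most \<open>x\<close> and the
      tail is at least its value at \<open>b\<close>.\<close>
    show "\<exists>B. \<forall>x. a \<le> x \<and> x \<le> b \<longrightarrow> r x \<le> B" if "0 < a" for a b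
    proof (intro exI allI impI)
      fix x assume x: "a \<le> x \<and> x \<le> b"
      have "truncated_mean M x / x \<le> 1"
        using x that truncated_mean_le[of x] by simp
      then have "r x \<le> 1 / prob {x<..}"
        using x that by (simp add: r_def divide_right_mono del: divide_divide_eq_left)
      also have "\<dots> \<le> 1 / prob {b<..}"
        using x pos tail_antimono by (intro divide_left_mono mult_pos_pos) auto
      finally show "r x \<le> 1 / prob {b<..}" .
    qed
  qed
  moreover have "\<forall>\<^sub>F x in at_top. r x = truncated_mean M x / x / prob {x<..}"
    using eventually_gt_at_top[of 0] by eventually_elim (simp add: r_def)
  ultimately show ?thesis by (rule Lim_transform_eventually)
qed

end

section \<open>The maximum dominates the rest of the sample\<close>

text \<open>The cap \<open>y \<le> x\<close> keeps the ratio in \<open>[0, 1]\<close>, hence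
  integrable without any moment assumption; for fixed \<open>x\<close> above \<open>u\<close> the
  mean over \<open>y\<close> is a truncated mean divided by \<open>x\<close>.\<close>

definition capped_ratio :: "real \<Rightarrow> real \<Rightarrow> real \<Rightarrow> real" where
  "capped_ratio u x y = (if u < x \<and> 0 < y \<and> y \<le> x then y / x else 0)"

lemma capped_ratio_bounds: "u > 0 \<Longrightarrow> 0 \<le> capped_ratio u x y" "u > 0 \<Longrightarrow> capped_ratio u x y \<le> 1"
  by (auto simp: capped_ratio_def)

lemma capped_ratio_measurable [measurable]:
  "(\<lambda>p. capped_ratio u (fst p) (snd p)) \<in> borel_measurable (borel \<Otimes>\<^sub>M borel)"
  unfolding capped_ratio_def by measurable

text \<open>By Fubini, for fixed \<open>x > u\<close> the inner integral is
  \<open>truncated_mean D x / x\<close>, at most \<open>e\<close> times the tail at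
  \<open>u\<close>. The outer integral runs over \<open>x > u\<close> only and yields the second
  tail factor.\<close>

lemma (in prob_space) expectation_capped_ratio_le:
  fixes X Y :: "'a \<Rightarrow> real"
  assumes ind: "indep_var borel X borel Y"
    and X: "distr M borel X = D" and Y: "distr M borel Y = D"
    and u: "u > 0" and e: "e \<ge> 0"
    and bound: "\<And>x. x \<ge> u \<Longrightarrow> truncated_mean D x / x \<le> e * measure D {x<..}"
  shows "expectation (\<lambda>\<omega>. capped_ratio u (X \<omega>) (Y \<omega>)) \<le> e * (measure D {u<..})\<^sup>2"
proof -
  have [measurable]: "random_variable borel X" "random_variable borel Y"
    using ind by (auto dest: indep_var_rv1 indep_var_rv2)
  interpret D: real_distribution D
    unfolding X[symmetric] by (rule real_distribution_distr) simp
  interpret P: pair_prob_space D D ..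
  have eq: "D \<Otimes>\<^sub>M D = distr M (borel \<Otimes>\<^sub>M borel) (\<lambda>\<omega>. (X \<omega>, Y \<omega>))"
    using ind X Y by (simp add: indep_var_distribution_eq)
  have int: "integrable (D \<Otimes>\<^sub>M D) (\<lambda>p. capped_ratio u (fst p) (snd p))"
    using u capped_ratio_bounds
    by (intro P.integrable_const_bound[of _ 1]) (auto intro!: AE_I2)
  have "expectation (\<lambda>\<omega>. capped_ratio u (X \<omega>) (Y \<omega>))
      = (\<integral>p. capped_ratio u (fst p) (snd p) \<partial>(D \<Otimes>\<^sub>M D))"
    unfolding eq by (subst integral_distr) auto
  also have "\<dots> = (\<integral>x. (\<integral>y. capped_ratio u x y \<partial>D) \<partial>D)"
    using P.integral_fst'[OF int] by simp
  also have "\<dots> \<le> (\<integral>x. indicator {u<..} x * (e * measure D {u<..}) \<partial>D)"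
  proof (rule integral_mono)
    show "integrable D (\<lambda>x. \<integral>y. capped_ratio u x y \<partial>D)"
      using P.integrable_fst'[OF int] by simp
    show "integrable D (\<lambda>x. indicator {u<..} x * (e * measure D {u<..}))"
      by (intro integrable_mult_left integrable_real_indicator) (auto simp: D.emeasure_eq_measure)
    fix x
    have "(\<lambda>y. capped_ratio u x y) = (\<lambda>y. indicator {u<..} x / x * (y * indicator {0<..x} y))"
      by (auto simp: capped_ratio_def fun_eq_iff)
    then have "(\<integral>y. capped_ratio u x y \<partial>D) = indicator {u<..} x * (truncated_mean D x / x)"
      by (simp add: truncated_mean_def)
    also have "\<dots> \<le> indicator {u<..} x * (e * measure D {u<..})"
    proof (cases "u < x")
      case True
      then have "truncated_mean D x / x \<le> e * measure D {x<..}" by (intro bound) simp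
      also have "\<dots> \<le> e * measure D {u<..}"
        using True e by (intro mult_left_mono D.tail_antimono) auto
      finally show ?thesis using True by simp
    qed simp
    finally show "(\<integral>y. capped_ratio u x y \<partial>D) \<le> indicator {u<..} x * (e * measure D {u<..})" .
  qed
  also have "\<dots> = e * (measure D {u<..})\<^sup>2"
    by (simp add: power2_eq_square)
  finally show ?thesis .
qed

text \<open>A small \<open>\<epsilon>\<close> means strong dominance. For nonnegative entries and
  positive \<open>\<epsilon>\<close> the strict inequality also forces
  \<open>x k > 0\<close>.\<close>

definition dominated_by_one :: "real \<Rightarrow> (nat \<Rightarrow> real) \<Rightarrow> nat \<Rightarrow> bool" where
  "dominated_by_one \<epsilon> x n \<longleftrightarrow> (\<exists>k\<le>n. (\<Sum>j\<in>{..n}-{k}. x j) < \<epsilon> * x k)"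

text \<open>Test the failure of dominance at an index of the maximum. There every other entry is at
  most \<open>x k\<close>, so the cap is inactive and the ratios form one inner sum of the
  nonnegative double sum.\<close>

lemma not_dominated_by_oneD:
  fixes x :: "nat \<Rightarrow> real"
  assumes nonneg: "\<And>k. x k \<ge> 0" and u: "u > 0"
    and not: "\<not> dominated_by_one \<epsilon> x n"
    and ex: "\<exists>k\<le>n. x k > u"
  shows "\<epsilon> \<le> (\<Sum>k\<le>n. \<Sum>j\<in>{..n}-{k}. capped_ratio u (x k) (x j))"
proof -
  define m where "m = Max (x ` {..n})"
  have "m \<in> x ` {..n}" unfolding m_def by (intro Max_in) auto
  then obtain k where k: "k \<le> n" "x k = m" by auto
  have le: "x j \<le> x k" if "j \<le> n" for j
    using that k by (simp add: m_def)
  have "x k > u" using ex le by force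
  have "\<epsilon> * x k \<le> (\<Sum>j\<in>{..n}-{k}. x j)"
    using not k by (auto simp: dominated_by_one_def not_less)
  then have "\<epsilon> \<le> (\<Sum>j\<in>{..n}-{k}. x j) / x k"
    using \<open>x k > u\<close> u by (simp add: field_simps)
  also have "\<dots> = (\<Sum>j\<in>{..n}-{k}. capped_ratio u (x k) (x j))"
    unfolding sum_divide_distrib
    using \<open>x k > u\<close> le nonneg by (intro sum.cong) (auto simp: capped_ratio_def le_less)
  also have "\<dots> \<le> (\<Sum>k\<le>n. \<Sum>j\<in>{..n}-{k}. capped_ratio u (x k) (x j))"
    using k u
    by (intro member_le_sum[where f = "\<lambda>k. \<Sum>j\<in>{..n}-{k}. capped_ratio u (x k) (x j)"] sum_nonneg)
       (auto intro: capped_ratio_bounds)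
  finally show ?thesis .
qed

text \<open>Union bound over two causes: all values stay below \<open>u\<close>, whose probability
  is a power by independence, or the sum \<open>W\<close> of capped ratios reaches
  \<open>\<epsilon>\<close>, which Markov's inequality controls.\<close>

lemma (in prob_space) prob_not_dominated_le:
  fixes X :: "nat \<Rightarrow> 'a \<Rightarrow> real"
  assumes ind: "indep_vars (\<lambda>_. borel) X UNIV"
    and D: "\<And>k. distr M borel (X k) = D"
    and nonneg: "\<And>k \<omega>. X k \<omega> \<ge> 0"
    and u: "u > 0" and e: "e \<ge> 0" and \<epsilon>: "\<epsilon> > 0"
    and bound: "\<And>x. x \<ge> u \<Longrightarrow> truncated_mean D x / x \<le> e * measure D {x<..}"
  shows "prob {\<omega> \<in> space M. \<not> dominated_by_one \<epsilon> (\<lambda>k. X k \<omega>) n}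
    \<le> (1 - measure D {u<..}) ^ Suc n + (real (Suc n) * measure D {u<..})\<^sup>2 * e / \<epsilon>"
proof -
  have rv [measurable]: "random_variable borel (X k)" for k
    using ind by (auto simp: indep_vars_def)
  define W where "W \<omega> = (\<Sum>k\<le>n. \<Sum>j\<in>{..n}-{k}. capped_ratio u (X k \<omega>) (X j \<omega>))" for \<omega>
  have W_meas [measurable]: "(\<lambda>\<omega>. capped_ratio u (X k \<omega>) (X j \<omega>)) \<in> borel_measurable M" for k j
    unfolding capped_ratio_def by measurable
  have W_int: "integrable M (\<lambda>\<omega>. capped_ratio u (X k \<omega>) (X j \<omega>))" for k j
    using u capped_ratio_bounds
    by (intro integrable_const_bound[of _ 1]) (auto intro!: AE_I2)
  \<comment> \<open>The sum over the singleton \<open>{j}\<close> is just \<open>X j\<close>, so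
    independence of \<open>X k\<close> from that sum is pairwise independence.\<close>
  have pair: "indep_var borel (X k) borel (X j)" if "j \<noteq> k" for j k
    using indep_vars_sum[of "{j}" k X] indep_vars_subset[OF ind, of "{k, j}"] that by simp
  have T1: "measure D {u<..} = prob {\<omega> \<in> space M. X k \<omega> > u}" for k
    unfolding D[symmetric, of k] by (subst measure_distr) (auto intro!: arg_cong[where f = prob])
  have "prob {\<omega> \<in> space M. X k \<omega> \<le> u} = 1 - measure D {u<..}" for k
  proof -
    have "{\<omega> \<in> space M. X k \<omega> \<le> u} = space M - {\<omega> \<in> space M. X k \<omega> > u}" by auto
    then show ?thesis unfolding T1[of k] by (simp add: prob_compl)
  qed
  then have "prob (X k -` {..u} \<inter> space M) = 1 - measure D {u<..}" for k
    by (simp add: vimage_def Int_def conj_commute)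
  then have "prob (\<Inter>k\<in>{..n}. X k -` {..u} \<inter> space M) = (1 - measure D {u<..}) ^ Suc n"
    using indep_varsD[OF ind, of "{..n}" "\<lambda>_. {..u}"] by (simp add: prod_constant)
  moreover have "(\<Inter>k\<in>{..n}. X k -` {..u} \<inter> space M) = {\<omega> \<in> space M. \<forall>k\<le>n. X k \<omega> \<le> u}"
    by auto
  ultimately have small: "prob {\<omega> \<in> space M. \<forall>k\<le>n. X k \<omega> \<le> u} = (1 - measure D {u<..}) ^ Suc n"
    by simp
  have "expectation W \<le> (\<Sum>k\<le>n. \<Sum>j\<in>{..n}-{k}. e * (measure D {u<..})\<^sup>2)"
    unfolding W_def using W_int
    by (subst Bochner_Integration.integral_sum, simp)
       (intro sum_mono, subst Bochner_Integration.integral_sum, simp,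
        intro sum_mono expectation_capped_ratio_le pair D u e bound, auto)
  \<comment> \<open>Adding the diagonal pairs makes the count exactly the square of
    \<open>Suc n\<close>.\<close>
  also have "\<dots> \<le> (\<Sum>k\<le>n. \<Sum>j\<le>n. e * (measure D {u<..})\<^sup>2)"
    using e by (intro sum_mono sum_mono2) auto
  also have "\<dots> = (real (Suc n) * measure D {u<..})\<^sup>2 * e"
    by (simp add: power2_eq_square algebra_simps)
  finally have EW: "expectation W \<le> (real (Suc n) * measure D {u<..})\<^sup>2 * e" .
  have "prob {\<omega> \<in> space M. \<not> dominated_by_one \<epsilon> (\<lambda>k. X k \<omega>) n}
      \<le> prob ({\<omega> \<in> space M. \<forall>k\<le>n. X k \<omega> \<le> u} \<union> {\<omega> \<in> space M. \<epsilon> \<le> W \<omega>})"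
    using not_dominated_by_oneD[of "\<lambda>k. X k \<omega>" u \<epsilon> n for \<omega>, OF nonneg u]
    by (intro finite_measure_mono) (fastforce simp: W_def not_le, simp add: W_def)
  also have "\<dots> \<le> prob {\<omega> \<in> space M. \<forall>k\<le>n. X k \<omega> \<le> u} + prob {\<omega> \<in> space M. \<epsilon> \<le> W \<omega>}"
    by (intro measure_Un_le) (simp_all add: W_def)
  also have "prob {\<omega> \<in> space M. \<epsilon> \<le> W \<omega>} \<le> expectation W / \<epsilon>"
    using W_int \<epsilon> u
    by (intro integral_Markov_inequality_measure[where A = "{}"])
       (auto simp: W_def intro!: sum_nonneg AE_I2 capped_ratio_bounds)
  also have "\<dots> \<le> (real (Suc n) * measure D {u<..})\<^sup>2 * e / \<epsilon>"
    using EW \<epsilon> by (intro divide_right_mono) auto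
  finally show ?thesis unfolding small by simp
qed

text \<open>The tail may jump, so n T(u) = L need not have a solution. Along
  \<open>w * 2 ^ m\<close>, the first \<open>m\<close> with n T \<le> L works: one step earlier the
  value exceeds \<open>L\<close>, and a doubling loses less than a factor 2.\<close>

lemma (in real_distribution) quantile_level:
  assumes pos: "\<And>x. prob {x<..} > 0"
    and sv: "((\<lambda>x. prob {x/2<..} / prob {x<..}) \<longlongrightarrow> 1) at_top"
    and L: "L > 0" and U: "U > 0"
  shows "\<forall>\<^sub>F n in sequentially. \<exists>u\<ge>U. L/2 \<le> real n * prob {u<..} \<and> real n * prob {u<..} \<le> L"
proof -
  have "\<forall>\<^sub>F x in at_top. prob {x/2<..} / prob {x<..} < 2"
    using sv by (rule order_tendstoD) simp
  then obtain V where V: "\<And>x. x \<ge> V \<Longrightarrow> prob {x/2<..} / prob {x<..} < 2"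
    by (auto simp: eventually_at_top_linorder)
  \<comment> \<open>Starting beyond \<open>V\<close> secures the factor 2 at every doubling; for
    large \<open>n\<close> the search starts above level \<open>L\<close>, so the first hit has a
    predecessor.\<close>
  define w where "w = max U V"
  have w: "w > 0" "w \<ge> U" "w \<ge> V" using U by (auto simp: w_def)
  have "filterlim (\<lambda>n. real n * prob {w<..}) at_top sequentially"
    using pos[of w] by real_asymp
  then have "\<forall>\<^sub>F n in sequentially. L < real n * prob {w<..}"
    by (simp add: filterlim_at_top_dense)
  then show ?thesis
  proof eventually_elim
    case (elim n)
    have "filterlim (\<lambda>m::nat. w * 2 ^ m) at_top sequentially"
      using w by real_asymp
    then have "(\<lambda>m. real n * prob {w * 2 ^ m<..}) \<longlonglongrightarrow> real n * 0"
      by (intro tendsto_mult tendsto_const filterlim_compose[OF tail_tendsto_0])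
    then have "\<forall>\<^sub>F m in sequentially. real n * prob {w * 2 ^ m<..} < L"
      using L by (intro order_tendstoD) auto
    then obtain m0 where m0: "real n * prob {w * 2 ^ m0<..} \<le> L"
      by (auto simp: eventually_sequentially intro: less_imp_le)
    define m where "m = (LEAST m. real n * prob {w * 2 ^ m<..} \<le> L)"
    have m: "real n * prob {w * 2 ^ m<..} \<le> L"
      unfolding m_def using m0 by (rule LeastI)
    then have "m \<noteq> 0" using elim by (intro notI) simp
    then obtain l where l: "m = Suc l" by (cases m) auto
    then have "\<not> real n * prob {w * 2 ^ l<..} \<le> L"
      unfolding m_def by (intro not_less_Least) simp
    then have gt: "L < real n * prob {w * 2 ^ m / 2<..}" by (simp add: l)
    have ge: "w \<le> w * 2 ^ m" using w by simp
    have "prob {w * 2 ^ m / 2<..} / prob {w * 2 ^ m<..} < 2"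
      using w ge by (intro V) linarith
    then have "prob {w * 2 ^ m / 2<..} \<le> 2 * prob {w * 2 ^ m<..}"
      by (simp only: pos_divide_less_eq[OF pos] less_imp_le)
    then have "real n * prob {w * 2 ^ m / 2<..} \<le> real n * (2 * prob {w * 2 ^ m<..})"
      by (rule mult_left_mono) simp
    with gt have "L/2 \<le> real n * prob {w * 2 ^ m<..}" by simp
    then show ?case using m order_trans[OF w(2) ge] by (intro exI[of _ "w * 2 ^ m"]) auto
  qed
qed

text \<open>The order of choices matters: \<open>L\<close> makes the exponential term less than
  \<open>\<tau>/2\<close>, then \<open>e\<close> makes the Markov term at most
  \<open>\<tau>/2\<close>, then \<open>U\<close> is where the truncated-mean bound with
  \<open>e\<close> starts, and only then does \<open>u \<ge> U\<close> depend on
  \<open>n\<close>.\<close>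

lemma (in prob_space) prob_not_dominated_tendsto_0:
  fixes X :: "nat \<Rightarrow> 'a \<Rightarrow> real"
  assumes ind: "indep_vars (\<lambda>_. borel) X UNIV"
    and D: "\<And>k. distr M borel (X k) = distr M borel (X 0)"
    and nonneg: "\<And>k \<omega>. X k \<omega> \<ge> 0"
    and sv: "slowly_varying_tail M (X 0)"
    and \<epsilon>: "\<epsilon> > 0"
  shows "(\<lambda>n. prob {\<omega> \<in> space M. \<not> dominated_by_one \<epsilon> (\<lambda>k. X k \<omega>) n}) \<longlonglongrightarrow> 0"
proof (rule order_tendstoI)
  fix \<tau> :: real assume \<tau>: "0 < \<tau>"
  have rv [measurable]: "random_variable borel (X k)" for k
    using ind by (auto simp: indep_vars_def)
  define D where "D = distr M borel (X 0)"
  interpret D: real_distribution D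
    unfolding D_def by (rule real_distribution_distr) simp
  have T: "measure D {x<..} = prob {\<omega> \<in> space M. X 0 \<omega> > x}" for x
    unfolding D_def by (subst measure_distr) (auto intro!: arg_cong[where f = prob])
  \<comment> \<open>Slow variation gives positivity for positive arguments only; monotonicity of the
    tail extends it to the whole line.\<close>
  have pos: "measure D {x<..} > 0" for x
  proof -
    have "0 < measure D {max x 1<..}"
      using sv unfolding T slowly_varying_tail_def by (simp del: max_less_iff_conj)
    also have "\<dots> \<le> measure D {x<..}" by (rule D.tail_antimono) simp
    finally show ?thesis .
  qed
  have half: "((\<lambda>x. measure D {x/2<..} / measure D {x<..}) \<longlongrightarrow> 1) at_top"
    using sv unfolding slowly_varying_tail_def T by (auto dest!: spec[of _ "1/2"])
  obtain L where L: "L > 0" "exp (- (L/2)) < \<tau>/2"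
  proof
    show "2 * (1 + \<bar>ln (\<tau>/2)\<bar>) > 0" by simp
    have "- (2 * (1 + \<bar>l\<bar>) / 2) < l" for l :: real by (simp add: abs_if field_simps)
    then have "exp (- (2 * (1 + \<bar>ln (\<tau>/2)\<bar>) / 2)) < exp (ln (\<tau>/2))"
      by (simp only: exp_less_cancel_iff)
    then show "exp (- (2 * (1 + \<bar>ln (\<tau>/2)\<bar>) / 2)) < \<tau>/2"
      by (simp only: exp_ln[OF half_gt_zero[OF \<tau>]])
  qed
  define e where "e = \<tau> * \<epsilon> / (2 * L\<^sup>2)"
  have e: "e > 0" using \<tau> \<epsilon> L by (simp add: e_def)
  have "\<forall>\<^sub>F x in at_top. truncated_mean D x / x / measure D {x<..} < e"
    using D.truncated_mean_small_o[OF pos half] e by (rule order_tendstoD)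
  then obtain U0 where U0: "\<And>x. x \<ge> U0 \<Longrightarrow> truncated_mean D x / x / measure D {x<..} < e"
    by (auto simp: eventually_at_top_linorder)
  define U where "U = max U0 1"
  have U: "U > 0" by (simp add: U_def)
  have bound: "truncated_mean D x / x \<le> e * measure D {x<..}" if "x \<ge> U" for x
  proof -
    have "truncated_mean D x / x / measure D {x<..} < e"
      using that by (intro U0) (simp add: U_def)
    then show ?thesis by (simp only: pos_divide_less_eq[OF pos] less_imp_le)
  qed
  \<comment> \<open>The indices 0 to \<open>n\<close> give \<open>Suc n\<close> sample values, hence
    the shift.\<close>
  have "\<forall>\<^sub>F n in sequentially. \<exists>u\<ge>U. L/2 \<le> real (Suc n) * measure D {u<..}
      \<and> real (Suc n) * measure D {u<..} \<le> L"
    using D.quantile_level[OF pos half L(1) U]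
    by (subst eventually_sequentially_Suc)
  then show "\<forall>\<^sub>F n in sequentially.
      prob {\<omega> \<in> space M. \<not> dominated_by_one \<epsilon> (\<lambda>k. X k \<omega>) n} < \<tau>"
  proof eventually_elim
    case (elim n)
    then obtain u where u: "u \<ge> U" "L/2 \<le> real (Suc n) * measure D {u<..}"
      "real (Suc n) * measure D {u<..} \<le> L" by blast
    have "prob {\<omega> \<in> space M. \<not> dominated_by_one \<epsilon> (\<lambda>k. X k \<omega>) n}
      \<le> (1 - measure D {u<..}) ^ Suc n + (real (Suc n) * measure D {u<..})\<^sup>2 * e / \<epsilon>"
    proof (rule prob_not_dominated_le[OF ind _ nonneg _ _ \<epsilon>])
      show "distr M borel (X k) = D" for k
        unfolding D_def by (rule assms(2))
      show "truncated_mean D x / x \<le> e * measure D {x<..}" if "x \<ge> u" for x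
        using that u by (intro bound) simp
    qed (use u U e in auto)
    moreover have "(1 - measure D {u<..}) ^ Suc n < \<tau>/2"
    proof -
      have "(1 - measure D {u<..}) ^ Suc n \<le> exp (- measure D {u<..}) ^ Suc n"
        using exp_ge_add_one_self[of "- measure D {u<..}"] by (intro power_mono) auto
      also have "\<dots> = exp (- (real (Suc n) * measure D {u<..}))"
        by (simp only: exp_of_nat_mult[symmetric] mult_minus_right)
      also have "\<dots> \<le> exp (- (L/2))" using u(2) by (simp only: exp_le_cancel_iff neg_le_iff_le)
      also have "\<dots> < \<tau>/2" by (rule L)
      finally show ?thesis .
    qed
    moreover have "(real (Suc n) * measure D {u<..})\<^sup>2 * e / \<epsilon> \<le> \<tau>/2"
    proof -
      have "(real (Suc n) * measure D {u<..})\<^sup>2 * e / \<epsilon> \<le> L\<^sup>2 * e / \<epsilon>"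
        using u(3) e \<epsilon> by (intro divide_right_mono mult_right_mono power_mono) auto
      also have "\<dots> = \<tau>/2" using L \<epsilon> by (simp add: e_def)
      finally show ?thesis .
    qed
    ultimately show ?case by linarith
  qed
qed (simp add: less_le_trans)

section \<open>Roots in the ring\<close>

lemma poly_random_poly: "poly (random_poly \<xi> n \<omega>) z = (\<Sum>k\<le>n. \<xi> k \<omega> * z ^ k)"
  by (simp add: random_poly_def poly_sum poly_monom)

text \<open>The bounds put 1 inside the ring, so the zero polynomial, with its infinite count, also
  fails the right-hand side. Otherwise a finite sum of positive orders vanishes only over the empty
  set.\<close>

lemma ring_roots_eq_0_iff:
  assumes "a \<le> 1" "1 \<le> b"
  shows "ring_roots a b p = 0 \<longleftrightarrow> (\<forall>z. a \<le> cmod z \<and> cmod z \<le> b \<longrightarrow> poly p z \<noteq> 0)"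
proof (cases "p = 0")
  case True
  then show ?thesis using assms by (auto simp: ring_roots_def intro!: exI[of _ 1])
next
  case False
  have "finite {z. poly p z = 0 \<and> a \<le> cmod z \<and> cmod z \<le> b}"
    by (rule finite_subset[OF _ poly_roots_finite[OF False]]) auto
  then show ?thesis
    using False by (auto simp: ring_roots_def order_root zero_enat_def)
qed

text \<open>One factor \<open>exp (- \<delta>)\<close> pays for the growth of the other powers of
  \<open>z\<close>, the second for the possible decay of the dominant one. A root would make the
  dominant term strictly smaller than itself in modulus.\<close>

lemma dominated_poly_no_root:
  fixes x :: "nat \<Rightarrow> complex"
  assumes dom: "dominated_by_one (exp (- 2 * \<delta>)) (\<lambda>k. cmod (x k)) n"
    and n: "n > 0" and \<delta>: "\<delta> > 0"
    and z: "exp (- \<delta> / real n) \<le> cmod z" "cmod z \<le> exp (\<delta> / real n)"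
  shows "(\<Sum>k\<le>n. x k * z ^ k) \<noteq> 0"
proof
  assume 0: "(\<Sum>k\<le>n. x k * z ^ k) = 0"
  obtain k where k: "k \<le> n" "(\<Sum>j\<in>{..n}-{k}. cmod (x j)) < exp (- 2 * \<delta>) * cmod (x k)"
    using dom by (auto simp: dominated_by_one_def)
  have frac: "real j * (\<delta> / real n) \<le> \<delta>" if "j \<le> n" for j
    using that n \<delta> by (simp add: field_simps)
  have up: "cmod z ^ j \<le> exp \<delta>" if "j \<le> n" for j
  proof -
    have "cmod z ^ j \<le> exp (\<delta> / real n) ^ j" using z by (intro power_mono) auto
    also have "\<dots> = exp (real j * (\<delta> / real n))" by (rule exp_of_nat_mult[symmetric])
    also have "\<dots> \<le> exp \<delta>" using frac[OF that] by simp
    finally show ?thesis .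
  qed
  have "exp (- \<delta>) \<le> exp (real k * (- \<delta> / real n))" using frac[OF k(1)] by simp
  also have "\<dots> = exp (- \<delta> / real n) ^ k" by (rule exp_of_nat_mult)
  also have "\<dots> \<le> cmod z ^ k" using z by (intro power_mono) auto
  finally have low: "exp (- \<delta>) \<le> cmod z ^ k" .
  have "x k * z ^ k = - (\<Sum>j\<in>{..n}-{k}. x j * z ^ j)"
    using 0 k by (simp add: sum.remove[of "{..n}" k] add_eq_0_iff)
  then have "cmod (x k) * cmod z ^ k = cmod (\<Sum>j\<in>{..n}-{k}. x j * z ^ j)"
    by (metis norm_minus_cancel norm_mult norm_power)
  also have "\<dots> \<le> (\<Sum>j\<in>{..n}-{k}. cmod (x j) * exp \<delta>)"
    using up by (intro sum_norm_le) (auto simp: norm_mult norm_power intro!: mult_left_mono)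
  also have "\<dots> = (\<Sum>j\<in>{..n}-{k}. cmod (x j)) * exp \<delta>" by (simp add: sum_distrib_right)
  also have "\<dots> < exp (- 2 * \<delta>) * cmod (x k) * exp \<delta>" using k by simp
  also have "\<dots> = cmod (x k) * exp (- \<delta>)"
    by (simp add: mult_exp_exp mult.assoc mult.left_commute)
  also have "\<dots> \<le> cmod (x k) * cmod z ^ k" using low by (intro mult_left_mono) auto
  finally show False by simp
qed

text \<open>A continuous function has no zero on a compact set iff it is bounded away from zero on a
  countable dense subset, which makes the event measurable.\<close>

lemma measurable_no_zero_on_compact:
  fixes f :: "'a \<Rightarrow> complex \<Rightarrow> complex"
  assumes K: "compact K"
    and cont: "\<And>\<omega>. continuous_on K (f \<omega>)"
    and meas [measurable]: "\<And>z. (\<lambda>\<omega>. f \<omega> z) \<in> borel_measurable M"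
  shows "{\<omega> \<in> space M. \<forall>z\<in>K. f \<omega> z \<noteq> 0} \<in> sets M"
proof -
  obtain C where C: "countable C" "C \<subseteq> K" "K \<subseteq> closure C"
    by (rule separable)
  have "(\<forall>z\<in>K. f \<omega> z \<noteq> 0) \<longleftrightarrow> (\<exists>m. \<forall>z\<in>C. 1 / real (Suc m) \<le> cmod (f \<omega> z))" for \<omega>
  proof
    assume nz: "\<forall>z\<in>K. f \<omega> z \<noteq> 0"
    show "\<exists>m. \<forall>z\<in>C. 1 / real (Suc m) \<le> cmod (f \<omega> z)"
    proof (cases "K = {}")
      case False
      obtain z0 where z0: "z0 \<in> K" "\<And>z. z \<in> K \<Longrightarrow> cmod (f \<omega> z0) \<le> cmod (f \<omega> z)"
        using continuous_attains_inf[OF K False continuous_on_norm[OF cont]] by blast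
      obtain m where "inverse (real (Suc m)) < cmod (f \<omega> z0)"
        using reals_Archimedean[of "cmod (f \<omega> z0)"] nz z0 by auto
      then show ?thesis
        using z0 C by (intro exI[of _ m]) (force simp: inverse_eq_divide)
    qed (use C in auto)
  next
    assume "\<exists>m. \<forall>z\<in>C. 1 / real (Suc m) \<le> cmod (f \<omega> z)"
    then obtain m where m: "\<And>z. z \<in> C \<Longrightarrow> 1 / real (Suc m) \<le> cmod (f \<omega> z)" by blast
    have "closure C \<subseteq> K"
      using C K by (simp add: closure_minimal compact_imp_closed)
    then have cont': "continuous_on (closure C) (\<lambda>z. cmod (f \<omega> z))"
      by (intro continuous_on_norm continuous_on_subset[OF cont])
    have "1 / real (Suc m) \<le> cmod (f \<omega> z)" if "z \<in> K" for z
      using that C(3) by (intro continuous_ge_on_closure[OF cont' _ m]) auto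
    moreover have "0 < 1 / real (Suc m)" by simp
    ultimately show "\<forall>z\<in>K. f \<omega> z \<noteq> 0"
      by (metis norm_zero not_less)
  qed
  moreover have "{\<omega> \<in> space M. \<exists>m. \<forall>z\<in>C. 1 / real (Suc m) \<le> cmod (f \<omega> z)} \<in> sets M"
    using C(1) by measurable
  ultimately show ?thesis by simp
qed

theorem theorem1:
  fixes M :: "'a measure" and \<xi> :: "nat \<Rightarrow> 'a \<Rightarrow> complex" and \<delta> :: real
  assumes "prob_space M"
    and "prob_space.indep_vars M (\<lambda>_. borel) \<xi> UNIV"
    and "\<And>k. distr M borel (\<xi> k) = distr M borel (\<xi> 0)"
    and "measure M {\<omega> \<in> space M. \<xi> 0 \<omega> = 0} = 0"
    and "slowly_varying_tail M (\<lambda>\<omega>. cmod (\<xi> 0 \<omega>))"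
    and "\<delta> > 0"
  shows "(\<lambda>n. measure M {\<omega> \<in> space M.
            ring_roots (exp (- \<delta> / real n)) (exp (\<delta> / real n)) (random_poly \<xi> n \<omega>) = 0})
         \<longlonglongrightarrow> 1"
proof -
  interpret prob_space M by fact
  have rv [measurable]: "random_variable borel (\<xi> k)" for k
    using assms(2) by (auto simp: indep_vars_def)
  define X where "X k \<omega> = cmod (\<xi> k \<omega>)" for k \<omega>
  have ind: "indep_vars (\<lambda>_. borel) X UNIV"
    unfolding X_def by (rule indep_vars_compose2[OF assms(2)]) simp
  have [measurable]: "random_variable borel (X k)" for k
    unfolding X_def by measurable
  have "distr M borel (X k) = distr (distr M borel (\<xi> k)) borel cmod" for k
    unfolding X_def by (subst distr_distr) (auto simp: comp_def)
  then have D: "distr M borel (X k) = distr M borel (X 0)" for k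
    using assms(3)[of k] by simp
  let ?bad = "\<lambda>n. {\<omega> \<in> space M. \<not> dominated_by_one (exp (- 2 * \<delta>)) (\<lambda>k. X k \<omega>) n}"
  let ?good = "\<lambda>n. {\<omega> \<in> space M.
    ring_roots (exp (- \<delta> / real n)) (exp (\<delta> / real n)) (random_poly \<xi> n \<omega>) = 0}"
  have "(\<lambda>n. prob (?bad n)) \<longlonglongrightarrow> 0"
    using assms(5) by (intro prob_not_dominated_tendsto_0 ind D) (auto simp: X_def)
  then have lim: "(\<lambda>n. 1 - prob (?bad n)) \<longlonglongrightarrow> 1"
    using tendsto_diff[OF tendsto_const[of 1]] by fastforce
  have good_iff: "ring_roots (exp (- \<delta> / real n)) (exp (\<delta> / real n)) (random_poly \<xi> n \<omega>) = 0
      \<longleftrightarrow> (\<forall>z\<in>{z. exp (- \<delta> / real n) \<le> cmod z \<and> cmod z \<le> exp (\<delta> / real n)}.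
        (\<Sum>k\<le>n. \<xi> k \<omega> * z ^ k) \<noteq> 0)" for n \<omega>
    using assms(6) by (subst ring_roots_eq_0_iff) (auto simp: poly_random_poly)
  \<comment> \<open>Monotonicity of \<open>prob\<close> needs the larger event measurable, since
    \<open>measure\<close> is 0 by default on other sets.\<close>
  have good_meas: "?good n \<in> events" for n
    unfolding good_iff
  proof (rule measurable_no_zero_on_compact)
    have "bounded {z. exp (- \<delta> / real n) \<le> cmod z \<and> cmod z \<le> exp (\<delta> / real n)}"
      by (auto simp: bounded_iff)
    moreover have "closed {z. exp (- \<delta> / real n) \<le> cmod z \<and> cmod z \<le> exp (\<delta> / real n)}"
      by (intro closed_Collect_conj closed_Collect_le continuous_intros)
    ultimately show "compact {z. exp (- \<delta> / real n) \<le> cmod z \<and> cmod z \<le> exp (\<delta> / real n)}"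
      by (simp add: compact_eq_bounded_closed)
  qed (auto intro!: continuous_intros)
  have bad_meas: "?bad n \<in> events" for n
    unfolding dominated_by_one_def by measurable
  \<comment> \<open>Restricting to \<open>n > 0\<close> avoids the default value of division by 0 in
    the radii.\<close>
  have "\<forall>\<^sub>F n in sequentially. 1 - prob (?bad n) \<le> prob (?good n)"
    using eventually_gt_at_top[of 0]
  proof eventually_elim
    case (elim n)
    have "space M - ?bad n \<subseteq> ?good n"
      unfolding good_iff using dominated_poly_no_root[OF _ elim assms(6)]
      by (auto simp: X_def)
    then have "prob (space M - ?bad n) \<le> prob (?good n)"
      using good_meas by (intro finite_measure_mono)
    then show ?case using prob_compl[OF bad_meas] by simp
  qed
  then show ?thesis
    by (rule tendsto_sandwich[OF _ _ lim tendsto_const]) simp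
qed

end
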